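(* $\mathrm{ex}(n,\overrightarrow{C}_3,\overrightarrow{C}_6)=\frac{1}{4}n^2+o(n^2)$.
   Context: An oriented graph is a directed graph without loops in which every pair of vertices is joined by at most one arc. $\overrightarrow{C}_m$ denotes the directed cycle of length $m$. A copy of $H$ in $G$ is a (not necessarily induced) subgraph isomorphic to $H$. $\mathrm{ex}(n,\overrightarrow{C}_k,\overrightarrow{C}_\ell)$ is the maximum number of copies of $\overrightarrow{C}_k$ in an $n$-vertex oriented graph containing no copy of $\overrightarrow{C}_\ell$. *)

theory Defs
  imports Complex_Main "HOL-Library.Landau_Symbols" "Graph_Theory.Graph_Theory"
begin

locale oriented_graph = pair_digraph +
  assumes no_opposite_arcs: "(u, v) \<in> parcs G \<Longrightarrow> (v, u) \<notin> parcs G"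

text \<open>The directed cycle of length \<open>m\<close>; it is an oriented graph for \<open>m \<ge> 3\<close>.\<close>

definition dicycle :: "nat \<Rightarrow> nat pair_pre_digraph" where
  "dicycle m = \<lparr> pverts = {..<m}, parcs = {(i, Suc i mod m) | i. i < m} \<rparr>"

definition copies :: "'b pair_pre_digraph \<Rightarrow> 'a pair_pre_digraph \<Rightarrow> 'a pair_pre_digraph set" where
  "copies H G = {K. subgraph (with_proj K) (with_proj G) \<and> digraph_iso (with_proj K) (with_proj H)}"

text \<open>Every finite graph has an isomorphic copy with vertices in \<^typ>\<open>nat\<close>, so it is no
  restriction to take the maximum over these.\<close>

definition admissible :: "nat \<Rightarrow> nat \<Rightarrow> nat pair_pre_digraph set" where
  "admissible n l = {G. oriented_graph G \<and> card (pverts G) = n \<and> copies (dicycle l) G = {}}"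

definition ex_dicycle :: "nat \<Rightarrow> nat \<Rightarrow> nat \<Rightarrow> nat" where
  "ex_dicycle n k l = Max {card (copies (dicycle k) G) | G. G \<in> admissible n l}"

text \<open>The maximum is over a finite nonempty set, and it counts finite sets of copies.\<close>

lemma copies_bound:
  assumes "oriented_graph G" "card (pverts G) = n"
  shows "finite (copies H G)" and "card (copies H G) \<le> 2 ^ n * 2 ^ (n * n)"
proof -
  interpret oriented_graph G by fact
  let ?f = "\<lambda>K. (pverts K, parcs K)"
  let ?P = "Pow (pverts G) \<times> Pow (pverts G \<times> pverts G)"
  have inj: "inj_on ?f (copies H G)"
    by (auto intro!: inj_onI)
  have sub: "?f ` copies H G \<subseteq> ?P"
    by (auto simp: copies_def subgraph_def dest: in_arcsD1 in_arcsD2)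
  have fin: "finite ?P"
    using pair_finite_verts by simp
  show "finite (copies H G)"
    using inj sub fin by (meson finite_imageD finite_subset)
  have "card (copies H G) \<le> card ?P"
    by (rule card_inj_on_le[OF inj sub fin])
  also have "\<dots> = 2 ^ n * 2 ^ (n * n)"
    using pair_finite_verts assms(2) by (simp add: card_cartesian_product card_Pow)
  finally show "card (copies H G) \<le> 2 ^ n * 2 ^ (n * n)" .
qed

lemma finite_copy_counts: "finite {card (copies (dicycle k) G) | G. G \<in> admissible n l}"
  by (rule finite_subset[of _ "{..2 ^ n * 2 ^ (n * n)}"])
    (auto simp: admissible_def intro: copies_bound)

lemma admissible_nonempty:
  assumes "l \<ge> 1"
  shows "admissible n l \<noteq> {}"
proof -
  let ?G = "\<lparr> pverts = {..<n}, parcs = {} \<rparr> :: nat pair_pre_digraph"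
  have "oriented_graph ?G"
    by unfold_locales auto
  moreover have "copies (dicycle l) ?G = {}"
    using assms
    by (auto simp: copies_def subgraph_def digraph_iso_def app_iso_def with_proj_def dicycle_def)
  ultimately have "?G \<in> admissible n l"
    by (simp add: admissible_def)
  then show ?thesis
    by blast
qed

end

theory Submission
  imports Defs "HOL-Analysis.Convex" "HOL-Real_Asymp.Real_Asymp"
begin

text \<open>
  Lower bound: a hub \<open>0\<close> with \<open>0 \<rightarrow> A \<rightarrow> B \<rightarrow> 0\<close> complete between two halves \<open>A\<close>, \<open>B\<close> of the other
  vertices; every directed cycle passes through the hub, so it is a triangle.

  Upper bound: let \<open>c \<rightarrow> a \<rightarrow> b\<close> be a path whose two arcs lie in triangles \<open>a b' c\<close> and \<open>a b c'\<close> with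
  \<open>b' \<noteq> b\<close> and \<open>c' \<noteq> c\<close>. A second path \<open>c \<rightarrow> a' \<rightarrow> b\<close> would give the 6-cycle \<open>a b' c a' b c'\<close>, so \<open>a\<close>
  is determined by \<open>(c, b)\<close>. Hence there are \<open>O(n\<^sup>2)\<close> paths of length two whose arcs both lie in
  triangles. Each triangle has a vertex \<open>a\<close> whose two arcs are both in no other triangle, or both in
  another triangle. In the first case the opposite arcs form a matching for each \<open>a\<close>, and
  Cauchy--Schwarz leaves \<open>O(n\<^bsup>3/2\<^esup>)\<close> such triangles. In the second case the triangle is determined by
  the arc opposite \<open>a\<close>. The number of two-arc paths formed by these opposite arcs is \<open>O(n\<^sup>2)\<close>, so up
  to \<open>O(n\<^bsup>3/2\<^esup>)\<close> of them they go from sources to sinks, which leaves at most \<open>n\<^sup>2/4\<close> of them.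
\<close>

section \<open>Copies of a directed cycle as cyclic sequences of vertices\<close>

text \<open>The inverse of the vertex map of an isomorphism onto the cycle enumerates the copy;
  conversely, inverting an injective closed sequence gives an isomorphism. A copy is a subgraph, so
  all rotations of \<open>f\<close> describe the same one.\<close>

lemma copies_dicycle:
  assumes "pair_wf_digraph G" "m > 0"
  shows "copies (dicycle m) G =
    {\<lparr> pverts = f ` {..<m}, parcs = {(f i, f (Suc i mod m)) | i. i < m} \<rparr> | f.
       inj_on f {..<m} \<and> (\<forall>i<m. (f i, f (Suc i mod m)) \<in> parcs G)}" (is "_ = ?R")
proof (intro equalityI subsetI)
  interpret pair_wf_digraph G by fact
  fix K assume "K \<in> copies (dicycle m) G"
  then have sub: "subgraph (with_proj K) (with_proj G)"
    and iso: "digraph_iso (with_proj K) (with_proj (dicycle m))"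
    by (auto simp: copies_def)
  from iso obtain h where h: "pre_digraph.digraph_isomorphism (with_proj K) h"
    and eq: "with_proj (dicycle m) = app_iso h (with_proj K)"
    by (auto simp: digraph_iso_def)
  define g where "g = iso_verts h"
  define f where "f = the_inv_into (pverts K) g"
  \<comment> \<open>An isomorphism carries its own arc map. Equality of the records forces the new
    tail and head to be the projections, so the vertex map determines the arc map.\<close>
  have tail: "iso_tail h = fst" and head: "iso_head h = snd"
    and V: "g ` pverts K = {..<m}"
    and A: "iso_arcs h ` parcs K = {(i, Suc i mod m) | i. i < m}"
    using eq by (auto simp: with_proj_def app_iso_def dicycle_def g_def)
  have inj: "inj_on g (pverts K)" and wfK: "wf_digraph (with_proj K)"
    using h by (auto simp: pre_digraph.digraph_isomorphism_def g_def)
  have arcs: "iso_arcs h e = (g (fst e), g (snd e))" if "e \<in> parcs K" for e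
    using h that by (auto simp: pre_digraph.digraph_isomorphism_def g_def tail head prod_eq_iff)
  have bij: "bij_betw f {..<m} (pverts K)"
    unfolding f_def by (rule bij_betw_the_inv_into) (use inj V in \<open>simp add: bij_betw_def\<close>)
  have fg: "f (g u) = u" if "u \<in> pverts K" for u
    unfolding f_def using inj that by (rule the_inv_into_f_f)
  have KV: "fst e \<in> pverts K" "snd e \<in> pverts K" if "e \<in> parcs K" for e
    using wf_digraph.tail_in_verts[OF wfK, of e] wf_digraph.head_in_verts[OF wfK, of e] that
    by auto
  have E: "parcs K = {(f i, f (Suc i mod m)) | i. i < m}"
  proof -
    have "(\<lambda>p. (f (fst p), f (snd p))) ` iso_arcs h ` parcs K = (\<lambda>e. e) ` parcs K"
      unfolding image_image by (rule image_cong) (simp_all add: arcs fg KV)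
    then have "parcs K = (\<lambda>p. (f (fst p), f (snd p))) ` {(i, Suc i mod m) | i. i < m}"
      by (simp add: A)
    also have "\<dots> = {(f i, f (Suc i mod m)) | i. i < m}"
      by (simp add: setcompr_eq_image image_image)
    finally show ?thesis .
  qed
  have "K = \<lparr> pverts = f ` {..<m}, parcs = {(f i, f (Suc i mod m)) | i. i < m} \<rparr>"
    using E bij by (intro pair_pre_digraph.equality) (auto simp: bij_betw_def)
  moreover have "(f i, f (Suc i mod m)) \<in> parcs G" if "i < m" for i
    using E sub that by (auto simp: subgraph_def)
  ultimately show "K \<in> ?R"
    using bij unfolding bij_betw_def by blast
next
  interpret pair_wf_digraph G by fact
  fix K assume "K \<in> ?R"
  then obtain f where inj: "inj_on f {..<m}"
    and arcs: "\<And>i. i < m \<Longrightarrow> (f i, f (Suc i mod m)) \<in> parcs G"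
    and K: "K = \<lparr> pverts = f ` {..<m}, parcs = {(f i, f (Suc i mod m)) | i. i < m} \<rparr>"
    by blast
  define g where "g = the_inv_into {..<m} f"
  have gf: "g (f i) = i" if "i < m" for i
    unfolding g_def using inj that by (intro the_inv_into_f_f) auto
  have wf: "wf_digraph (with_proj K)"
    using \<open>m > 0\<close> by unfold_locales (auto simp: K)
  have "f ` {..<m} \<subseteq> pverts G"
    using arcs in_arcsD1 by blast
  then have sub: "subgraph (with_proj K) (with_proj G)"
    using wf arcs by (auto simp: subgraph_def K compatible_def wf_digraph_axioms)
  define h where "h = \<lparr> iso_verts = g, iso_arcs = map_prod g g, iso_head = snd, iso_tail = fst \<rparr>"
  have injg: "inj_on g (f ` {..<m})"
    using gf by (auto intro!: inj_onI)
  have "pre_digraph.digraph_isomorphism (with_proj K) h"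
    unfolding pre_digraph.digraph_isomorphism_def
    using wf injg \<open>m > 0\<close> gf by (auto simp: h_def K intro!: inj_onI)
  moreover have "with_proj (dicycle m) = app_iso h (with_proj K)"
  proof -
    have "g ` f ` {..<m} = {..<m}"
      using gf by (force simp: image_image)
    moreover have "map_prod g g ` {(f i, f (Suc i mod m)) | i. i < m} = {(i, Suc i mod m) | i. i < m}"
      (is "?A = ?B")
    proof -
      have "?A = (\<lambda>i. (g (f i), g (f (Suc i mod m)))) ` {..<m}"
        by (simp add: setcompr_eq_image image_image lessThan_def)
      also have "\<dots> = (\<lambda>i. (i, Suc i mod m)) ` {..<m}"
        using gf \<open>m > 0\<close> by (intro image_cong) auto
      finally show ?thesis by auto
    qed
    ultimately show ?thesis
      by (simp add: with_proj_def app_iso_def dicycle_def h_def K)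
  qed
  ultimately show "K \<in> copies (dicycle m) G"
    using sub by (auto simp: copies_def digraph_iso_def)
qed

section \<open>Two counting inequalities\<close>

lemma sum_le_sqrt_sum_squares:
  fixes f :: "'a \<Rightarrow> real" and s :: real
  assumes "(\<Sum>x\<in>A. (f x)\<^sup>2) \<le> s"
  shows "(\<Sum>x\<in>A. f x) \<le> sqrt (card A * s)"
proof (rule real_le_rsqrt)
  have "(\<Sum>x\<in>A. f x)\<^sup>2 \<le> card A * (\<Sum>x\<in>A. (f x)\<^sup>2)"
    using Cauchy_Schwarz_ineq_sum[of "\<lambda>_. 1" f A] by simp
  also have "\<dots> \<le> card A * s"
    using assms by (simp add: mult_left_mono)
  finally show "(\<Sum>x\<in>A. f x)\<^sup>2 \<le> card A * s" .
qed

text \<open>Call \<open>v\<close> a source if its in-degree is at most its out-degree, and a sink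
  otherwise. At most |V|^2/4 pairs go from sources to sinks. Every other pair ends in a source or
  starts in a sink, and is charged to the smaller degree there.\<close>

lemma card_relation_le_min_degrees:
  assumes fin: "finite V" and sub: "F \<subseteq> V \<times> V"
  shows "real (card F) \<le> (real (card V))\<^sup>2 / 4 + (\<Sum>v\<in>V. real (min (card (F `` {v})) (card (F\<inverse> `` {v}))))"
proof -
  let ?o = "\<lambda>v. card (F `` {v})" and ?i = "\<lambda>v. card (F\<inverse> `` {v})"
  define X where "X = {v \<in> V. ?i v \<le> ?o v}"
  have finF: "finite F"
    using fin sub finite_subset by blast
  have finX: "finite X" "X \<subseteq> V" using fin by (auto simp: X_def)
  have fin': "finite (F `` {v})" "finite (F\<inverse> `` {v})" for v
    using finF by auto
  have "F \<subseteq> X \<times> (V - X) \<union> (SIGMA v:X. F\<inverse> `` {v})\<inverse> \<union> (SIGMA v:V - X. F `` {v})"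
    using sub by auto
  then have "card F \<le> card (X \<times> (V - X) \<union> (SIGMA v:X. F\<inverse> `` {v})\<inverse> \<union> (SIGMA v:V - X. F `` {v}))"
    using fin finX fin' by (intro card_mono) (auto intro!: finite_SigmaI)
  also have "\<dots> \<le> card (X \<times> (V - X)) + card ((SIGMA v:X. F\<inverse> `` {v})\<inverse>) + card (SIGMA v:V - X. F `` {v})"
    by (meson card_Un_le order_trans add_right_mono)
  also have "\<dots> = card X * (card V - card X) + (\<Sum>v\<in>X. ?i v) + (\<Sum>v\<in>V - X. ?o v)"
    using fin finX fin' by (simp add: card_cartesian_product card_Diff_subset card_inverse)
  also have "(\<Sum>v\<in>X. ?i v) = (\<Sum>v\<in>X. min (?o v) (?i v))"
    by (intro sum.cong) (auto simp: X_def)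
  also have "(\<Sum>v\<in>V - X. ?o v) = (\<Sum>v\<in>V - X. min (?o v) (?i v))"
    by (intro sum.cong) (auto simp: X_def)
  finally have le: "card F \<le> card X * (card V - card X) + (\<Sum>v\<in>V. min (?o v) (?i v))"
    using sum.subset_diff[OF finX(2) fin, of "\<lambda>v. min (?o v) (?i v)"] by simp
  have "real (card X * (card V - card X)) = real (card X) * (real (card V) - real (card X))"
    using card_mono[OF fin finX(2)] by (simp add: of_nat_diff)
  also have "\<dots> \<le> (real (card V))\<^sup>2 / 4"
    using zero_le_power2[of "real (card V) - 2 * real (card X)"]
    by (simp add: power2_eq_square algebra_simps)
  finally have "real (card X * (card V - card X)) \<le> (real (card V))\<^sup>2 / 4" .
  moreover have "real (card F) \<le> real (card X * (card V - card X)) + real (\<Sum>v\<in>V. min (?o v) (?i v))"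
    using le by (simp only: flip: of_nat_add of_nat_le_iff[where 'a = real])
  ultimately show ?thesis
    unfolding of_nat_sum by linarith
qed


section \<open>Triangles and 6-cycles in terms of arcs\<close>

definition triangle_graph :: "'a \<Rightarrow> 'a \<Rightarrow> 'a \<Rightarrow> 'a pair_pre_digraph" where
  "triangle_graph a b c = \<lparr> pverts = {a, b, c}, parcs = {(a, b), (b, c), (c, a)} \<rparr>"

lemma triangle_graph_rotate: "triangle_graph a b c = triangle_graph b c a"
  by (auto simp: triangle_graph_def)

lemma Collect_less_3: "{g i | i. i < (3::nat)} = {g 0, g 1, g 2}"
proof -
  have "{i. i < (3::nat)} = {0, 1, 2}" by auto
  then show ?thesis by (simp add: setcompr_eq_image)
qed

lemma copies_dicycle_3:
  assumes "oriented_graph G"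
  shows "copies (dicycle 3) G =
    {triangle_graph a b c | a b c. (a, b) \<in> parcs G \<and> (b, c) \<in> parcs G \<and> (c, a) \<in> parcs G}"
    (is "_ = ?R")
proof -
  interpret oriented_graph G by fact
  have less3: "{..<3::nat} = {0, 1, 2}" by auto
  have wf: "pair_wf_digraph G" ..
  have shape: "\<lparr> pverts = f ` {..<3}, parcs = {(f i, f (Suc i mod 3)) | i. i < 3} \<rparr>
      = triangle_graph (f 0) (f 1) (f 2)" for f :: "nat \<Rightarrow> 'a"
    unfolding Collect_less_3 by (simp add: less3 triangle_graph_def numeral_2_eq_2)
  show ?thesis
  proof (intro equalityI subsetI)
    fix K assume "K \<in> copies (dicycle 3) G"
    then obtain f where K: "K = triangle_graph (f 0) (f 1) (f 2)"
      and *: "\<forall>i<3. (f i, f (Suc i mod 3)) \<in> parcs G"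
      unfolding copies_dicycle[OF wf, of 3, simplified] shape by blast
    have "(f 0, f 1) \<in> parcs G" "(f 1, f 2) \<in> parcs G" "(f 2, f 0) \<in> parcs G"
      using *[rule_format, of 0] *[rule_format, of 1] *[rule_format, of 2] by (simp_all add: numeral_2_eq_2)
    with K show "K \<in> ?R" by blast
  next
    fix K assume "K \<in> ?R"
    then obtain a b c where K: "K = triangle_graph a b c"
      and abc: "(a, b) \<in> parcs G" "(b, c) \<in> parcs G" "(c, a) \<in> parcs G" by blast
    define f where "f = (!) [a, b, c]"
    have f: "f 0 = a" "f 1 = b" "f 2 = c" "f (Suc 0) = b" by (auto simp: f_def)
    have "a \<noteq> b" "b \<noteq> c" "c \<noteq> a"
      using abc pair_no_loops by fastforce+
    then have inj: "inj_on f {..<3}"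
      by (auto simp: less3 f)
    have "(f i, f (Suc i mod 3)) \<in> parcs G" if "i < 3" for i
    proof -
      from that have "i = 0 \<or> i = 1 \<or> i = 2" by auto
      then show ?thesis using abc f by (auto simp: numeral_2_eq_2)
    qed
    moreover have "K = \<lparr> pverts = f ` {..<3}, parcs = {(f i, f (Suc i mod 3)) | i. i < 3} \<rparr>"
      unfolding shape K f ..
    ultimately show "K \<in> copies (dicycle 3) G"
      using inj unfolding copies_dicycle[OF wf, of 3, simplified] by blast
  qed
qed

lemma copies_dicycle_6_empty_iff:
  assumes "oriented_graph G"
  shows "copies (dicycle 6) G = {} \<longleftrightarrow>
    (\<forall>a b c d e g. distinct [a, b, c, d, e, g] \<longrightarrow> (a, b) \<in> parcs G \<longrightarrow> (b, c) \<in> parcs G \<longrightarrow>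
      (c, d) \<in> parcs G \<longrightarrow> (d, e) \<in> parcs G \<longrightarrow> (e, g) \<in> parcs G \<longrightarrow> (g, a) \<notin> parcs G)"
proof -
  interpret oriented_graph G by fact
  have less6: "{..<6::nat} = {0, 1, 2, 3, 4, 5}" by auto
  have wf: "pair_wf_digraph G" ..
  have "copies (dicycle 6) G \<noteq> {} \<longleftrightarrow>
      (\<exists>f. inj_on f {..<6} \<and> (\<forall>i\<in>{..<6}. (f i, f (Suc i mod 6)) \<in> parcs G))"
    unfolding copies_dicycle[OF wf, of 6, simplified] by auto
  also have "\<dots> \<longleftrightarrow> (\<exists>f::nat \<Rightarrow> 'a. distinct [f 0, f 1, f 2, f 3, f 4, f 5] \<and>
      (f 0, f 1) \<in> parcs G \<and> (f 1, f 2) \<in> parcs G \<and> (f 2, f 3) \<in> parcs G \<and>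
      (f 3, f 4) \<in> parcs G \<and> (f 4, f 5) \<in> parcs G \<and> (f 5, f 0) \<in> parcs G)"
    unfolding less6 by (rule ex_cong1) (auto simp: inj_on_def numeral_2_eq_2[symmetric])
  also have "\<dots> \<longleftrightarrow> (\<exists>a b c d e g. distinct [a, b, c, d, e, g] \<and>
      (a, b) \<in> parcs G \<and> (b, c) \<in> parcs G \<and> (c, d) \<in> parcs G \<and>
      (d, e) \<in> parcs G \<and> (e, g) \<in> parcs G \<and> (g, a) \<in> parcs G)" (is "?L \<longleftrightarrow> ?R")
  proof
    assume ?R
    then obtain a b c d e g where *: "distinct [a, b, c, d, e, g]"
      "(a, b) \<in> parcs G" "(b, c) \<in> parcs G" "(c, d) \<in> parcs G"
      "(d, e) \<in> parcs G" "(e, g) \<in> parcs G" "(g, a) \<in> parcs G" by blast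
    show ?L
      by (rule exI[of _ "(!) [a, b, c, d, e, g]"]) (use * in simp)
  qed blast
  finally show ?thesis by blast
qed

section \<open>Counting triangles without 6-cycles\<close>

locale C6_free_digraph =
  fixes V :: "'a set" and E :: "('a \<times> 'a) set"
  assumes finite_V: "finite V"
    and E_subset: "E \<subseteq> V \<times> V"
    and asym: "(u, v) \<in> E \<Longrightarrow> (v, u) \<notin> E"
    and no_C6: "\<lbrakk>distinct [a, b, c, d, e, f]; (a, b) \<in> E; (b, c) \<in> E; (c, d) \<in> E; (d, e) \<in> E;
      (e, f) \<in> E\<rbrakk> \<Longrightarrow> (f, a) \<notin> E"
begin

definition tri :: "'a \<Rightarrow> 'a \<Rightarrow> 'a \<Rightarrow> bool" where
  "tri a b c \<longleftrightarrow> (a, b) \<in> E \<and> (b, c) \<in> E \<and> (c, a) \<in> E"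

text \<open>The first two arguments are the arc, the third is the excluded apex:
  \<open>other_tri c a b\<close> concerns the arc from \<open>c\<close> to \<open>a\<close>.\<close>

definition other_tri :: "'a \<Rightarrow> 'a \<Rightarrow> 'a \<Rightarrow> bool" where
  "other_tri a b c \<longleftrightarrow> (\<exists>c'. c' \<noteq> c \<and> tri a b c')"

definition tri_in :: "'a \<Rightarrow> 'a set" where
  "tri_in a = {c. \<exists>b. tri a b c}"

definition tri_out :: "'a \<Rightarrow> 'a set" where
  "tri_out a = {b. \<exists>c. tri a b c}"

lemma tri_rotate: "tri a b c \<Longrightarrow> tri b c a"
  by (auto simp: tri_def)

lemma tri_in_V: "tri a b c \<Longrightarrow> a \<in> V \<and> b \<in> V \<and> c \<in> V"
  using E_subset by (auto simp: tri_def)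

lemma finite_tri_in: "finite (tri_in a)" and finite_tri_out: "finite (tri_out a)"
  using finite_V tri_in_V by (auto simp: tri_in_def tri_out_def intro: finite_subset[of _ V])

lemma middle_unique:
  assumes "other_tri a b c" "other_tri c a b" "(c, a') \<in> E" "(a', b) \<in> E"
  shows "a' = a"
proof (rule ccontr)
  assume "a' \<noteq> a"
  obtain c' where c': "c' \<noteq> c" "(a, b) \<in> E" "(b, c') \<in> E" "(c', a) \<in> E"
    using assms(1) by (auto simp: other_tri_def tri_def)
  obtain b' where b': "b' \<noteq> b" "(c, a) \<in> E" "(a, b') \<in> E" "(b', c) \<in> E"
    using assms(2) by (auto simp: other_tri_def tri_def)
  \<comment> \<open>The pairs \<open>a\<close>, \<open>a'\<close> and \<open>b\<close>,
    \<open>b'\<close> and \<open>c\<close>, \<open>c'\<close> differ by assumption; any other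
    coincidence would produce a loop or two opposite arcs.\<close>
  have "distinct [a, b', c, a', b, c']"
    using assms(3,4) b' c' \<open>a' \<noteq> a\<close> asym by auto
  then show False
    using no_C6 b' c' assms(3,4) by blast
qed

text \<open>The sum counts the paths \<open>c\<close>, \<open>a\<close>, \<open>b\<close> whose two
  arcs lie in triangles. They fall into three classes, in each of which two of the vertices
  determine the third, so each class has at most |V|^2 members.\<close>

lemma sum_tri_degrees: "(\<Sum>a\<in>V. card (tri_in a) * card (tri_out a)) \<le> 3 * (card V)\<^sup>2"
proof -
  define D where "D = (SIGMA a:V. tri_in a \<times> tri_out a)"
  define A where "A = {(a, c, b) \<in> D. other_tri a b c \<and> other_tri c a b}"
  define B where "B = {(a, c, b) \<in> D. \<not> other_tri a b c}"
  define C where "C = {(a, c, b) \<in> D. \<not> other_tri c a b}"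
  have D_V: "D \<subseteq> V \<times> V \<times> V"
    using tri_in_V by (auto simp: D_def tri_in_def tri_out_def)
  have card_VV: "card (V \<times> V) = (card V)\<^sup>2" "finite (V \<times> V)"
    using finite_V by (auto simp: card_cartesian_product power2_eq_square)
  have D_tri: "(\<exists>b'. tri a b' c) \<and> (\<exists>c'. tri a b c')" if "(a, c, b) \<in> D" for a b c
    using that by (auto simp: D_def tri_in_def tri_out_def)
  have "a = a'" if "(a, c, b) \<in> A" "(a', c, b) \<in> A" for a a' b c
  proof -
    have "other_tri a b c" "other_tri c a b"
      using that(1) by (auto simp: A_def)
    moreover have "(c, a') \<in> E" "(a', b) \<in> E"
      using that(2) D_tri[of a' c b] by (auto simp: A_def tri_def)
    ultimately show ?thesis using middle_unique by blast
  qed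
  then have "inj_on (\<lambda>(a, c, b). (c, b)) A"
    by (auto simp: inj_on_def)
  then have A: "card A \<le> (card V)\<^sup>2"
    unfolding card_VV(1)[symmetric]
    by (rule card_inj_on_le[OF _ _ card_VV(2)]) (use D_V in \<open>auto simp: A_def\<close>)
  \<comment> \<open>The arc from \<open>a\<close> to \<open>b\<close> lies in some triangle but in
    none with apex other than \<open>c\<close>, so \<open>c\<close> is its apex.\<close>
  have "c = c'" if "(a, c, b) \<in> B" "(a, c', b) \<in> B" for a b c c'
    using that D_tri[of a c b] by (auto simp: B_def other_tri_def)
  then have "inj_on (\<lambda>(a, c, b). (a, b)) B"
    by (auto simp: inj_on_def)
  then have B: "card B \<le> (card V)\<^sup>2"
    unfolding card_VV(1)[symmetric]
    by (rule card_inj_on_le[OF _ _ card_VV(2)]) (use D_V in \<open>auto simp: B_def\<close>)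
  have "b = b'" if "(a, c, b) \<in> C" "(a, c, b') \<in> C" for a b b' c
    using that D_tri[of a c b] by (auto simp: C_def other_tri_def tri_def)
  then have "inj_on (\<lambda>(a, c, b). (a, c)) C"
    by (auto simp: inj_on_def)
  then have C: "card C \<le> (card V)\<^sup>2"
    unfolding card_VV(1)[symmetric]
    by (rule card_inj_on_le[OF _ _ card_VV(2)]) (use D_V in \<open>auto simp: C_def\<close>)
  have "(\<Sum>a\<in>V. card (tri_in a) * card (tri_out a)) = card D"
    using finite_V finite_tri_in finite_tri_out by (simp add: D_def card_cartesian_product)
  also have "D = A \<union> B \<union> C"
    by (auto simp: A_def B_def C_def)
  also have "card \<dots> \<le> card A + card B + card C"
    by (meson card_Un_le order_trans add_right_mono)
  finally show ?thesis using A B C by simp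
qed

text \<open>Triples are marked at their first vertex \<open>a\<close>; the arc opposite
  \<open>a\<close> may be of either kind.\<close>

definition thin :: "('a \<times> 'a \<times> 'a) set" where
  "thin = {(a, b, c). tri a b c \<and> \<not> other_tri a b c \<and> \<not> other_tri c a b}"

definition thick :: "('a \<times> 'a \<times> 'a) set" where
  "thick = {(a, b, c). tri a b c \<and> other_tri a b c \<and> other_tri c a b}"

lemma finite_thin: "finite thin" and finite_thick: "finite thick"
  by (rule finite_subset[of _ "V \<times> V \<times> V"]; use finite_V tri_in_V in \<open>auto simp: thin_def thick_def\<close>)+

text \<open>Two of the three arcs of a triangle agree on whether they lie in a further triangle, and a
  rotation makes them the two arcs at the first vertex.\<close>

lemma tri_thin_or_thick:
  assumes "tri a b c"
  shows "triangle_graph a b c \<in> (\<lambda>(x, y, z). triangle_graph x y z) ` (thin \<union> thick)"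
proof -
  have "tri a b c" "tri b c a" "tri c a b"
    using assms tri_rotate by blast+
  then have "(a, b, c) \<in> thin \<union> thick \<or> (b, c, a) \<in> thin \<union> thick \<or> (c, a, b) \<in> thin \<union> thick"
    unfolding thin_def thick_def by blast
  moreover have "triangle_graph a b c = triangle_graph b c a" "triangle_graph a b c = triangle_graph c a b"
    by (metis triangle_graph_rotate)+
  ultimately show ?thesis
    by (elim disjE) (auto intro: rev_image_eqI)
qed

text \<open>For fixed \<open>a\<close>, each of \<open>b\<close> and \<open>c\<close> determines the
  other, so \<open>M a\<close> is no larger than \<open>tri_out a\<close> or
  \<open>tri_in a\<close>. Its squared size is thus at most their product, which
  \<open>sum_tri_degrees\<close> sums and Cauchy-Schwarz converts.\<close>

lemma card_thin: "real (card thin) \<le> sqrt (3 * real (card V) ^ 3)"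
proof -
  define M where "M a = {(b, c). (a, b, c) \<in> thin}" for a
  have fin_M: "finite (M a)" for a
    by (rule finite_subset[of _ "V \<times> V"]; use finite_V tri_in_V in \<open>auto simp: M_def thin_def\<close>)
  have "card (M a) \<le> card (tri_out a)" for a
    by (rule card_inj_on_le[of fst, OF _ _ finite_tri_out])
      (auto simp: M_def thin_def tri_out_def other_tri_def intro!: inj_onI)
  moreover have "card (M a) \<le> card (tri_in a)" for a
    by (rule card_inj_on_le[of snd, OF _ _ finite_tri_in])
      (auto simp: M_def thin_def tri_in_def other_tri_def tri_def intro!: inj_onI)
  ultimately have "(card (M a))\<^sup>2 \<le> card (tri_in a) * card (tri_out a)" for a
    unfolding power2_eq_square by (intro mult_mono) auto
  then have "(\<Sum>a\<in>V. (card (M a))\<^sup>2) \<le> 3 * (card V)\<^sup>2"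
    by (rule order_trans[OF sum_mono sum_tri_degrees])
  then have "(\<Sum>a\<in>V. (real (card (M a)))\<^sup>2) \<le> 3 * (real (card V))\<^sup>2"
    by (simp only: flip: of_nat_le_iff[where 'a = real]) simp
  then have "(\<Sum>a\<in>V. real (card (M a))) \<le> sqrt (real (card V) * (3 * (real (card V))\<^sup>2))"
    by (rule sum_le_sqrt_sum_squares)
  moreover have "thin = (SIGMA a:V. M a)"
    using tri_in_V by (auto simp: M_def thin_def)
  ultimately show ?thesis
    using finite_V fin_M by (simp add: power2_eq_square power3_eq_cube mult_ac)
qed

text \<open>By \<open>middle_unique\<close> the opposite arc determines the triple, so it suffices
  to count the relation \<open>F\<close> of opposite arcs. Its degrees at \<open>v\<close> are
  bounded by the sizes of \<open>tri_out v\<close> and \<open>tri_in v\<close>, so the sum of the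
  smaller degrees is controlled as for \<open>thin\<close>.\<close>

lemma card_thick: "real (card thick) \<le> (real (card V))\<^sup>2 / 4 + sqrt (3 * real (card V) ^ 3)"
proof -
  define F where "F = (\<lambda>(a, b, c). (b, c)) ` thick"
  let ?o = "\<lambda>v. card (F `` {v})" and ?i = "\<lambda>v. card (F\<inverse> `` {v})"
  have "inj_on (\<lambda>(a, b, c). (b, c)) thick"
    using middle_unique by (auto simp: thick_def tri_def intro!: inj_onI)
  then have card_F: "card thick = card F"
    unfolding F_def by (simp add: card_image)
  have F_V: "F \<subseteq> V \<times> V"
    using tri_in_V by (auto simp: F_def thick_def)
  have "F `` {v} \<subseteq> tri_out v" "F\<inverse> `` {v} \<subseteq> tri_in v" for v
    by (auto simp: F_def thick_def tri_out_def tri_in_def tri_def)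
  then have "?o v \<le> card (tri_out v)" "?i v \<le> card (tri_in v)" for v
    by (simp_all add: card_mono finite_tri_in finite_tri_out)
  then have "(min (?o v) (?i v))\<^sup>2 \<le> card (tri_in v) * card (tri_out v)" for v
    unfolding power2_eq_square by (intro mult_mono) (auto simp: min.coboundedI1 min.coboundedI2)
  then have "(\<Sum>v\<in>V. (min (?o v) (?i v))\<^sup>2) \<le> 3 * (card V)\<^sup>2"
    by (rule order_trans[OF sum_mono sum_tri_degrees])
  then have "(\<Sum>v\<in>V. (real (min (?o v) (?i v)))\<^sup>2) \<le> 3 * (real (card V))\<^sup>2"
    by (simp only: flip: of_nat_le_iff[where 'a = real]) (simp del: of_nat_min)
  then have "(\<Sum>v\<in>V. real (min (?o v) (?i v))) \<le> sqrt (real (card V) * (3 * (real (card V))\<^sup>2))"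
    by (rule sum_le_sqrt_sum_squares)
  also have "\<dots> = sqrt (3 * real (card V) ^ 3)"
    by (simp add: power2_eq_square power3_eq_cube mult_ac)
  finally show ?thesis
    using card_relation_le_min_degrees[OF finite_V F_V] card_F by linarith
qed

lemma card_triangle_graphs:
  "real (card {triangle_graph a b c | a b c. tri a b c})
    \<le> (real (card V))\<^sup>2 / 4 + 2 * sqrt (3 * real (card V) ^ 3)"
proof -
  let ?g = "\<lambda>(a, b, c). triangle_graph a b c"
  have "{triangle_graph a b c | a b c. tri a b c} \<subseteq> ?g ` (thin \<union> thick)"
    using tri_thin_or_thick by blast
  then have "card {triangle_graph a b c | a b c. tri a b c} \<le> card (thin \<union> thick)"
    using finite_thin finite_thick by (meson surj_card_le finite_UnI)
  also have "\<dots> \<le> card thin + card thick"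
    by (rule card_Un_le)
  finally show ?thesis
    using card_thin card_thick by linarith
qed

end

section \<open>The upper bound\<close>

lemma ex_dicycle_3_6_upper:
  "real (ex_dicycle n 3 6) \<le> (real n)\<^sup>2 / 4 + 2 * sqrt (3 * real n ^ 3)"
proof -
  let ?S = "{card (copies (dicycle 3) G) | G. G \<in> admissible n 6}"
  have "ex_dicycle n 3 6 \<in> ?S"
    unfolding ex_dicycle_def
    by (rule Max_in[OF finite_copy_counts]) (use admissible_nonempty[of 6 n] in auto)
  then obtain G where "G \<in> admissible n 6" and ex: "ex_dicycle n 3 6 = card (copies (dicycle 3) G)"
    by blast
  then have G: "oriented_graph G" "card (pverts G) = n" "copies (dicycle 6) G = {}"
    by (auto simp: admissible_def)
  interpret oriented_graph G by fact
  interpret C6: C6_free_digraph "pverts G" "parcs G"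
  proof
    show "parcs G \<subseteq> pverts G \<times> pverts G"
      by (auto dest: in_arcsD1 in_arcsD2)
  next
    fix a b c d e f
    assume "distinct [a, b, c, d, e, f]" "(a, b) \<in> parcs G" "(b, c) \<in> parcs G"
      "(c, d) \<in> parcs G" "(d, e) \<in> parcs G" "(e, f) \<in> parcs G"
    then show "(f, a) \<notin> parcs G"
      using G(3)[unfolded copies_dicycle_6_empty_iff[OF G(1)]] by blast
  qed (use pair_finite_verts no_opposite_arcs in auto)
  show ?thesis
    using C6.card_triangle_graphs G(2) unfolding ex copies_dicycle_3[OF G(1)] C6.tri_def by simp
qed

section \<open>The lower bound construction\<close>

definition hub_graph :: "nat \<Rightarrow> nat \<Rightarrow> nat pair_pre_digraph" where
  "hub_graph m n = \<lparr> pverts = {..<n},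
     parcs = {0} \<times> {1..m} \<union> {1..m} \<times> {m<..<n} \<union> {m<..<n} \<times> {0} \<rparr>"

text \<open>Every path with two arcs meets the hub \<open>0\<close>. A 6-cycle contains two disjoint
  such paths, which cannot both contain it.\<close>

lemma hub_graph_admissible:
  assumes "m < n"
  shows "hub_graph m n \<in> admissible n 6"
proof -
  have fin: "finite (parcs (hub_graph m n))" by (simp add: hub_graph_def)
  have G: "oriented_graph (hub_graph m n)"
    by unfold_locales (use assms fin in \<open>auto simp: hub_graph_def\<close>)
  have hub: "0 \<in> {u, v, w}" if "(u, v) \<in> parcs (hub_graph m n)" "(v, w) \<in> parcs (hub_graph m n)" for u v w
    using that by (auto simp: hub_graph_def)
  have "copies (dicycle 6) (hub_graph m n) = {}"
    unfolding copies_dicycle_6_empty_iff[OF G]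
  proof (intro allI impI notI)
    fix a b c d e f
    assume "distinct [a, b, c, d, e, f]"
      and "(a, b) \<in> parcs (hub_graph m n)" "(b, c) \<in> parcs (hub_graph m n)"
        "(d, e) \<in> parcs (hub_graph m n)" "(e, f) \<in> parcs (hub_graph m n)"
    then show False
      using hub[of a b c] hub[of d e f] by auto
  qed
  with G show ?thesis
    by (simp add: admissible_def hub_graph_def)
qed

text \<open>Each of the \<open>m * (n - Suc m)\<close> arcs between the two halves closes to a
  triangle through the hub, and is the only arc of that triangle avoiding \<open>0\<close>; hence
  the triangles are distinct.\<close>

lemma ex_dicycle_3_6_lower:
  assumes "m < n"
  shows "m * (n - Suc m) \<le> ex_dicycle n 3 6"
proof -
  let ?G = "hub_graph m n"
  have G: "oriented_graph ?G"
    using hub_graph_admissible[OF assms] by (simp add: admissible_def)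
  let ?g = "\<lambda>(a, b). triangle_graph (0::nat) a b"
  have "a = a' \<and> b = b'" if "triangle_graph 0 a b = triangle_graph 0 a' b'" "a > 0" "b > 0"
    for a b a' b' :: nat
  proof -
    have "(a, b) \<in> parcs (triangle_graph 0 a' b')"
      using that(1) by (metis insertCI pair_pre_digraph.select_convs(2) triangle_graph_def)
    then show ?thesis
      using that(2,3) by (auto simp: triangle_graph_def)
  qed
  then have "inj_on ?g ({1..m} \<times> {m<..<n})"
    by (fastforce intro!: inj_onI)
  moreover have "?g ` ({1..m} \<times> {m<..<n}) \<subseteq> copies (dicycle 3) ?G"
    unfolding copies_dicycle_3[OF G] by (fastforce simp: hub_graph_def)
  moreover have "finite (copies (dicycle 3) ?G)"
    using copies_bound(1)[OF G] by blast
  ultimately have "card ({1..m} \<times> {m<..<n}) \<le> card (copies (dicycle 3) ?G)"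
    by (rule card_inj_on_le)
  also have "\<dots> \<le> ex_dicycle n 3 6"
    unfolding ex_dicycle_def
    by (rule Max_ge[OF finite_copy_counts]) (use hub_graph_admissible[OF assms] in auto)
  finally show ?thesis
    by (simp add: card_cartesian_product)
qed

lemma ex_dicycle_3_6_lower_quadratic:
  "(real n)\<^sup>2 / 4 - real n / 2 \<le> real (ex_dicycle n 3 6)"
proof (cases "n = 0")
  case False
  \<comment> \<open>The \<open>n - 1\<close> vertices other than the hub are halved. For n = 2m + 2
    the claimed bound is exactly m(m + 1); for n = 2m + 1 it is m^2 - 1/4.\<close>
  define m where "m = (n - 1) div 2"
  have m: "m < n" using False by (auto simp: m_def)
  have "n = 2 * m + 1 \<or> n = 2 * m + 2"
    using False unfolding m_def by presburger
  then have "(real n)\<^sup>2 / 4 - real n / 2 \<le> real m * (real n - (real m + 1))"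
    by (auto simp: power2_eq_square algebra_simps)
  also have "\<dots> = real (m * (n - Suc m))"
    using m by (simp add: of_nat_diff)
  also have "\<dots> \<le> real (ex_dicycle n 3 6)"
    using ex_dicycle_3_6_lower[OF m] by (simp only: of_nat_le_iff)
  finally show ?thesis .
qed simp

theorem theorem4p1:
  shows "(\<lambda>n. real (ex_dicycle n 3 6) - 1 / 4 * real n ^ 2) \<in> o(\<lambda>n. real n ^ 2)"
proof -
  \<comment> \<open>The lower bound contributes the error n/2 and the upper bound the error of order
    n^(3/2); their sum dominates both.\<close>
  have "(\<lambda>n. real (ex_dicycle n 3 6) - 1 / 4 * real n ^ 2) \<in> O(\<lambda>n. real n / 2 + 2 * sqrt (3 * real n ^ 3))"
  proof (rule bigoI[of _ 1], rule always_eventually, rule allI)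
    fix n :: nat
    define y where "y = sqrt (3 * real n ^ 3)"
    have "0 \<le> y" by (simp add: y_def)
    then have "\<bar>real (ex_dicycle n 3 6) - 1 / 4 * real n ^ 2\<bar> \<le> real n / 2 + 2 * y"
      using ex_dicycle_3_6_upper[of n] ex_dicycle_3_6_lower_quadratic[of n]
      by (intro abs_leI) (auto simp flip: y_def)
    then show "norm (real (ex_dicycle n 3 6) - 1 / 4 * real n ^ 2)
        \<le> 1 * norm (real n / 2 + 2 * sqrt (3 * real n ^ 3))"
      by (simp add: y_def)
  qed
  also have "(\<lambda>n. real n / 2 + 2 * sqrt (3 * real n ^ 3)) \<in> o(\<lambda>n. real n ^ 2)"
    by real_asymp
  finally show ?thesis .
qed

end
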